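(* For every $q\in(0,1)$ there exists a constant $c=c(q)>0$ such that for every integer $n\ge 1$ there exist two distinct strings $x,y\in\{0,1\}^n$ with the following property: for every integer $j\ge 0$ and every integer $T\ge 1$, the total variation distance between the laws of $\bigl(\widetilde{X}^t_j\bigr)_{t=1}^T$ and $\bigl(\widetilde{Y}^t_j\bigr)_{t=1}^T$ is at most $T\exp(-c\,n^{1/3})$. Here $\widetilde{X}^1,\dots,\widetilde{X}^T$ are i.i.d. outputs of the deletion channel with deletion probability $q$ applied to $x$, and $\widetilde{Y}^1,\dots,\widetilde{Y}^T$ are i.i.d. outputs of the same channel applied to $y$.
   Context: Deletion channel with deletion probability $q$ (retention probability $p=1-q$): given an input string $x=(x_0,\dots,x_{n-1})\in\{0,1\}^n$, each bit $x_k$ is independently deleted with probability $q$ and retained with probability $p$; the output $\widetilde{X}=(\widetilde X_0,\widetilde X_1,\dots)$ is the string obtained by concatenating the retained bits in their original order, with no gaps, and then padding with zeros to the right (so $\widetilde{X}_j$ is defined for all $j\ge 0$, with $\widetilde X_j=0$ if at most $j$ bits were retained). $\widetilde{X}^t_j$ denotes the $j$th bit (indexing from $0$) of the $t$-th sample. The total variation distance between laws $\mu,\nu$ is $\sup_A|\mu(A)-\nu(A)|$. *)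

theory Defs
  imports "HOL-Probability.Probability"
begin

text \<open>Bits are booleans, with 0 = \<open>False\<close> and 1 = \<open>True\<close>.\<close>

definition zero_pad :: "bool list \<Rightarrow> nat \<Rightarrow> bool" where
  "zero_pad w j = (if j < length w then w ! j else False)"

text \<open>\<open>R k\<close> says that the bit at position \<open>k\<close> is retained; the probability of this is
  \<open>1 - q\<close>.\<close>

definition deletion_channel :: "real \<Rightarrow> bool list \<Rightarrow> (nat \<Rightarrow> bool) pmf" where
  "deletion_channel q x =
     map_pmf (\<lambda>R. zero_pad (nths x {k. R k}))
       (Pi_pmf {..<length x} False (\<lambda>_. bernoulli_pmf (1 - q)))"

text \<open>The law of \<open>T\<close> independent outputs, each observed only at position \<open>j\<close>.\<close>

definition bit_samples :: "real \<Rightarrow> bool list \<Rightarrow> nat \<Rightarrow> nat \<Rightarrow> bool list pmf" where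
  "bit_samples q x j T =
     map_pmf (map (\<lambda>X. X j)) (replicate_pmf T (deletion_channel q x))"

definition tv_dist :: "'a pmf \<Rightarrow> 'a pmf \<Rightarrow> real" where
  "tv_dist \<mu> \<nu> = (SUP A. \<bar>measure_pmf.prob \<mu> A - measure_pmf.prob \<nu> A\<bar>)"

end

theory Submission
  imports Defs "HOL-Complex_Analysis.Complex_Analysis" "HOL-Real_Asymp.Real_Asymp"
begin

text \<open>
  A single observed bit is Bernoulli, so the total variation distance of \<open>T\<close> samples is at most
  \<open>T\<close> times the difference of the two success probabilities. With \<open>p = 1 - q\<close> and
  \<open>A(z) = \<Sum>\<^sub>k (x\<^sub>k - y\<^sub>k) z\<^sup>k\<close>, that difference is the \<open>j\<close>-th coefficient of
  \<open>w \<mapsto> p A(q + p w)\<close>, so by Cauchy's inequality it suffices to make \<open>A\<close> small on the circle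
  \<open>z = q + p w\<close>, \<open>|w| = 1\<close>. This circle touches the unit circle only at 1, and
  \<open>|z|\<^sup>2 = 1 - (q/p) |z - 1|\<^sup>2\<close> on it. Take \<open>A(z) = z\<^sup>h Q(z)\<close> with \<open>h\<close> of order \<open>n\<close>. For
  \<open>|z - 1|\<close> at least of order \<open>n\<^bsup>-1/3\<^esup>\<close> the factor \<open>z\<^sup>h\<close> is small. For \<open>z\<close> closer to 1,
  \<open>Q\<close> is a difference of two polynomials with coefficients 0 and 1, of degree of order
  \<open>n\<^bsup>2/3\<^esup>\<close>, whose first Taylor coefficients at 1 almost agree; two such polynomials exist by the
  pigeonhole principle.
\<close>

section \<open>Total variation of independent bit samples\<close>

lemma prob_bind_bool_pmf:
  fixes M :: "bool pmf"
  shows "measure_pmf.prob (bind_pmf M N) A =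
    pmf M True * measure_pmf.prob (N True) A + (1 - pmf M True) * measure_pmf.prob (N False) A"
proof -
  \<comment> \<open>The probability of an event is the mass at \<open>True\<close> of its indicator,
    which lets \<open>pmf_bind\<close> condition on the first bit.\<close>
  have *: "measure_pmf.prob L A = pmf (map_pmf (\<lambda>x. x \<in> A) L) True" for L :: "'a pmf"
    by (auto simp: pmf_map vimage_def)
  show ?thesis
    unfolding * map_bind_pmf pmf_bind
    by (subst integral_measure_pmf_real[of UNIV]) (auto simp: UNIV_bool pmf_False_conv_True)
qed

text \<open>Condition on the first sample. The difference becomes a convex combination of
  differences for the remaining samples, plus the gap of the two success probabilities times a
  difference of two probabilities, which is at most 1 in absolute value. Each sample thus costs one
  gap.\<close>

lemma prob_replicate_bool_pmf_diff_le:
  fixes M N :: "bool pmf"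
  shows "\<bar>measure_pmf.prob (replicate_pmf T M) A - measure_pmf.prob (replicate_pmf T N) A\<bar>
    \<le> real T * \<bar>pmf M True - pmf N True\<bar>"
proof (induction T arbitrary: A)
  case 0
  then show ?case by simp
next
  case (Suc T)
  define P where "P b = measure_pmf.prob (replicate_pmf T M) (Cons b -` A)" for b
  define Q where "Q b = measure_pmf.prob (replicate_pmf T N) (Cons b -` A)" for b
  define a where "a = pmf M True"
  define c where "c = pmf N True"
  have Suc_eq: "measure_pmf.prob (replicate_pmf (Suc T) L) A =
      pmf L True * measure_pmf.prob (replicate_pmf T L) (Cons True -` A)
      + (1 - pmf L True) * measure_pmf.prob (replicate_pmf T L) (Cons False -` A)" for L
    by (simp add: prob_bind_bool_pmf flip: map_pmf_def)
  have a: "0 \<le> a" "a \<le> 1" by (simp_all add: a_def pmf_le_1)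
  have IH: "\<bar>P b - Q b\<bar> \<le> real T * \<bar>a - c\<bar>" for b
    using Suc.IH[of "Cons b -` A"] by (simp add: P_def Q_def a_def c_def)
  have "\<bar>a * P True + (1 - a) * P False - (c * Q True + (1 - c) * Q False)\<bar>
      = \<bar>a * (P True - Q True) + (1 - a) * (P False - Q False) + (a - c) * (Q True - Q False)\<bar>"
    by (simp add: algebra_simps)
  also have "\<dots> \<le> a * \<bar>P True - Q True\<bar> + (1 - a) * \<bar>P False - Q False\<bar>
      + \<bar>a - c\<bar> * \<bar>Q True - Q False\<bar>"
    using a by (intro order.trans[OF abs_triangle_ineq] add_mono) (auto simp: abs_mult)
  also have "\<dots> \<le> a * (real T * \<bar>a - c\<bar>) + (1 - a) * (real T * \<bar>a - c\<bar>) + \<bar>a - c\<bar> * 1"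
  proof (intro add_mono mult_left_mono IH)
    have "0 \<le> Q b" "Q b \<le> 1" for b by (simp_all add: Q_def)
    from this[of True] this[of False] show "\<bar>Q True - Q False\<bar> \<le> 1" by linarith
  qed (use a in auto)
  finally show ?case
    unfolding Suc_eq by (simp add: P_def Q_def a_def c_def algebra_simps)
qed

definition bit_prob :: "real \<Rightarrow> bool list \<Rightarrow> nat \<Rightarrow> real" where
  "bit_prob q x j = pmf (map_pmf (\<lambda>X. X j) (deletion_channel q x)) True"

lemma map_replicate_pmf:
  "map_pmf (map f) (replicate_pmf T M) = replicate_pmf T (map_pmf f M)"
proof (induction T)
  case (Suc T)
  show ?case
    by (simp add: map_bind_pmf bind_map_pmf map_pmf_comp flip: map_pmf_def Suc.IH)
qed simp

lemma tv_dist_bit_samples_le: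
  "tv_dist (bit_samples q x j T) (bit_samples q y j T) \<le> real T * \<bar>bit_prob q x j - bit_prob q y j\<bar>"
  unfolding tv_dist_def bit_samples_def map_replicate_pmf bit_prob_def
  by (intro cSUP_least prob_replicate_bool_pmf_diff_le) auto

section \<open>The law of one output bit\<close>

lemma zero_pad_snoc: "zero_pad (w @ [b]) j = (zero_pad w j \<or> (j = length w \<and> b))"
  by (auto simp: zero_pad_def nth_append)

text \<open>The appended bit reaches position \<open>j\<close> exactly when it is retained and
  \<open>j\<close> earlier bits are retained; the number of the latter is binomial. An appended
  \<open>False\<close> looks the same as padding and changes nothing.\<close>

lemma bit_prob_snoc:
  assumes q: "0 \<le> q" "q \<le> 1"
  shows "bit_prob q (x @ [b]) j =
    bit_prob q x j + of_bool b * (1 - q) * pmf (binomial_pmf (length x) (1 - q)) j"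
proof -
  define n where "n = length x"
  define D where "D = Pi_pmf {..<n} False (\<lambda>_. bernoulli_pmf (1 - q))"
  define E where "E = {R. zero_pad (nths x {k. R k}) j}"
  define F where "F = {R. length (nths x {k. R k}) = j}"
  have nths_upd: "nths x {k. (R(n := r)) k} = nths x {k. R k}" for R r
    by (auto simp: nths_def n_def set_zip intro!: arg_cong[of _ _ "map fst"] filter_cong)
  have nths_snoc: "nths (x @ [b]) {k. (R(n := r)) k} = nths x {k. R k} @ (if r then [b] else [])" for R r
    unfolding nths_append nths_upd by (auto simp: n_def)
  have bp: "bit_prob q x j = measure_pmf.prob D E"
    by (simp add: bit_prob_def deletion_channel_def pmf_map D_def n_def E_def vimage_def)
  have "{..<Suc n} = insert n {..<n}" by auto
  then have "Pi_pmf {..<Suc n} False (\<lambda>_. bernoulli_pmf (1 - q)) =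
      bind_pmf (bernoulli_pmf (1 - q)) (\<lambda>r. map_pmf (\<lambda>R. R(n := r)) D)"
    by (simp add: Pi_pmf_insert' D_def map_pmf_def)
  then have "bit_prob q (x @ [b]) j =
      measure_pmf.prob (bind_pmf (bernoulli_pmf (1 - q)) (\<lambda>r. map_pmf (\<lambda>R. R(n := r)) D))
        {R. zero_pad (nths (x @ [b]) {k. R k}) j}"
    by (simp add: bit_prob_def deletion_channel_def pmf_map vimage_def flip: n_def)
  also have "\<dots> = (1 - q) * measure_pmf.prob D {R. R \<in> E \<or> R \<in> F \<and> b} + q * measure_pmf.prob D E"
    unfolding prob_bind_bool_pmf measure_map_pmf vimage_def mem_Collect_eq nths_snoc
    using q by (simp add: zero_pad_snoc E_def F_def eq_commute[of j])
  also have "measure_pmf.prob D {R. R \<in> E \<or> R \<in> F \<and> b} =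
      measure_pmf.prob D E + of_bool b * measure_pmf.prob D F"
  proof (cases b)
    case True
    \<comment> \<open>If exactly \<open>j\<close> bits survive, position \<open>j\<close> is padding
      and hence \<open>False\<close>.\<close>
    have "E \<inter> F = {}" by (auto simp: E_def F_def zero_pad_def)
    then have "measure_pmf.prob D (E \<union> F) = measure_pmf.prob D E + measure_pmf.prob D F"
      by (intro measure_pmf.finite_measure_Union) auto
    then show ?thesis using True by (simp add: Un_def)
  qed simp
  also have "measure_pmf.prob D F = pmf (binomial_pmf n (1 - q)) j"
    by (subst binomial_pmf_altdef'[where A = "{..<n}" and dflt = False])
       (use q in \<open>auto simp: pmf_map D_def F_def vimage_def length_nths n_def\<close>)
  finally show ?thesis by (simp add: bp n_def algebra_simps)
qed

lemma bit_prob_eq: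
  assumes "0 \<le> q" "q \<le> 1"
  shows "bit_prob q x j =
    (\<Sum>k<length x. of_bool (x ! k) * (1 - q) * pmf (binomial_pmf k (1 - q)) j)"
proof (induction x rule: rev_induct)
  case Nil
  then show ?case
    by (simp add: bit_prob_def deletion_channel_def zero_pad_def)
next
  case (snoc b x)
  then show ?case
    by (simp add: bit_prob_snoc assms nth_append)
qed

section \<open>Generating functions and Cauchy's inequality\<close>

lemma norm_coeff_le_sup_circle:
  fixes a :: "nat \<Rightarrow> complex"
  assumes "\<And>w. norm w = 1 \<Longrightarrow> norm (\<Sum>i<n. a i * w ^ i) \<le> B" and "j < n"
  shows "norm (a j) \<le> B"
proof -
  define f where "f = (\<lambda>w. \<Sum>i<n. a i * w ^ i)"
  have exp: "f has_fps_expansion (\<Sum>i<n. fps_const (a i) * fps_X ^ i)"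
    unfolding f_def by (intro fps_expansion_intros)
  have "(deriv ^^ j) f 0 = fact j * fps_nth (\<Sum>i<n. fps_const (a i) * fps_X ^ i) j"
    using fps_nth_fps_expansion[OF exp, of j] by (simp add: field_simps)
  also have "fps_nth (\<Sum>i<n. fps_const (a i) * fps_X ^ i) j = (\<Sum>i<n. if i = j then a i else 0)"
    by (simp add: fps_sum_nth if_distrib cong: if_cong)
  also have "\<dots> = a j" using \<open>j < n\<close> by simp
  finally have "fact j * norm (a j) = norm ((deriv ^^ j) f 0)" by (simp add: norm_mult)
  also have "\<dots> \<le> fact j * B / 1 ^ j"
    by (rule Cauchy_inequality)
       (auto simp: f_def assms intro!: holomorphic_intros continuous_intros)
  finally show ?thesis by simp
qed

lemma binomial_pmf_gen_fun:
  fixes w :: complex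
  assumes "0 \<le> q" "q \<le> 1" "k < n"
  shows "(\<Sum>j<n. of_real (pmf (binomial_pmf k (1 - q)) j) * w ^ j) =
    (of_real q + of_real (1 - q) * w) ^ k"
proof -
  have "(\<Sum>j<n. of_real (pmf (binomial_pmf k (1 - q)) j) * w ^ j) =
      (\<Sum>j\<le>k. of_real (pmf (binomial_pmf k (1 - q)) j) * w ^ j)"
    using assms by (intro sum.mono_neutral_right) auto
  also have "\<dots> = (of_real (1 - q) * w + of_real q) ^ k"
    unfolding binomial_ring using assms
    by (intro sum.cong) (auto simp: power_mult_distrib)
  finally show ?thesis by (simp add: add.commute)
qed

text \<open>By the binomial theorem, the differences of bit probabilities are, up to the factor
  \<open>1 - q \<le> 1\<close>, the coefficients of the polynomial in \<open>w\<close> being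
  bounded, so Cauchy's inequality on the unit circle applies.\<close>

lemma bit_prob_diff_le_sup_circle:
  assumes q: "0 < q" "q < 1" and len: "length x = n" "length y = n"
    and bound: "\<And>w::complex. norm w = 1 \<Longrightarrow>
      norm (\<Sum>k<n. of_real (of_bool (x ! k) - of_bool (y ! k)) * (of_real q + of_real (1 - q) * w) ^ k) \<le> B"
  shows "\<bar>bit_prob q x j - bit_prob q y j\<bar> \<le> B"
proof -
  define a where "a k = (of_bool (x ! k) - of_bool (y ! k) :: real)" for k
  define d where "d j = (\<Sum>k<n. a k * pmf (binomial_pmf k (1 - q)) j)" for j
  have diff: "bit_prob q x j - bit_prob q y j = (1 - q) * d j"
    using q by (simp add: bit_prob_eq len d_def a_def sum_distrib_left algebra_simps flip: sum_subtractf)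
  have "0 \<le> B" using order.trans[OF norm_ge_zero bound[of 1]] by simp
  have "\<bar>d j\<bar> \<le> B"
  proof (cases "j < n")
    case True
    have "norm (complex_of_real (d j)) \<le> B"
    proof (rule norm_coeff_le_sup_circle[OF _ True])
      fix w :: complex assume w: "norm w = 1"
      have "(\<Sum>i<n. of_real (d i) * w ^ i) =
          (\<Sum>k<n. of_real (a k) * (\<Sum>i<n. of_real (pmf (binomial_pmf k (1 - q)) i) * w ^ i))"
        unfolding d_def of_real_sum sum_distrib_left sum_distrib_right
        by (subst sum.swap) (simp add: mult.assoc)
      also have "\<dots> = (\<Sum>k<n. of_real (a k) * (of_real q + of_real (1 - q) * w) ^ k)"
        using q by (intro sum.cong refl arg_cong2[of _ _ _ _ "(*)"] binomial_pmf_gen_fun) auto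
      finally show "norm (\<Sum>i<n. of_real (d i) * w ^ i) \<le> B"
        using bound[OF w] by (simp add: a_def)
    qed
    then show ?thesis by simp
  next
    case False
    \<comment> \<open>A string of length \<open>n\<close> never produces a bit at position
      \<open>j \<ge> n\<close>.\<close>
    then have "d j = 0" using q by (auto simp: d_def binomial_eq_0 intro!: sum.neutral)
    then show ?thesis using \<open>0 \<le> B\<close> by simp
  qed
  then have "\<bar>(1 - q) * d j\<bar> \<le> 1 * B"
    using q unfolding abs_mult by (intro mult_mono) auto
  then show ?thesis by (simp add: diff)
qed

section \<open>Pigeonhole: a polynomial that is small near 1\<close>

text \<open>Length times radius equals \<open>M\<close>, so Taylor coefficients at 1, rescaled by
  powers of the radius, are at most \<open>m * exp M\<close>. Rounding the first
  \<open>4 * M\<close> of them to precision \<open>exp (- M)\<close> gives fewer than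
  \<open>2 ^ m\<close> classes; two strings in one class have a difference with small initial
  coefficients, and its Taylor tail is small for any strings.\<close>

lemma exists_small_near_one:
  fixes M :: nat
  defines "m \<equiv> 24 * M ^ 2"
  assumes M: "1 \<le> M" "real m + 1 \<le> exp (real M)"
  shows "\<exists>u v :: bool list. length u = m \<and> length v = m \<and> u \<noteq> v \<and>
    (\<forall>z::complex. norm (z - 1) \<le> 1 / (24 * real M) \<longrightarrow>
      norm (\<Sum>i<m. of_real (of_bool (u ! i) - of_bool (v ! i)) * z ^ i) \<le> 28 * real M ^ 2 * exp (- real M))"
proof -
  \<comment> \<open>Four times \<open>M\<close>, so that the tail factor \<open>exp (- K)\<close>
    beats the growth \<open>exp (3 * M)\<close> and leaves \<open>exp (- M)\<close>.\<close>
  define K where "K = 4 * M"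
  define \<delta> where "\<delta> = 1 / (24 * real M)"
  have \<delta>: "\<delta> > 0" "real m * \<delta> = real M" using M by (simp_all add: \<delta>_def m_def power2_eq_square)
  \<comment> \<open>\<open>b u k\<close> is the \<open>k\<close>-th Taylor coefficient at 1 of the
    polynomial with coefficients \<open>u\<close>, and \<open>F u\<close> is the box containing the
    first \<open>K\<close> of them after rescaling.\<close>
  define b where "b u k = (\<Sum>i<m. of_bool (u ! i) * real (i choose k))" for u :: "bool list" and k
  define F where "F u = restrict (\<lambda>k. nat \<lfloor>b u k * \<delta> ^ k * exp (real M)\<rfloor>) {..<K}" for u
  define B where "B = nat \<lfloor>real m * exp (2 * real M)\<rfloor>"
  \<comment> \<open>Used with a singleton to bound one coefficient, and with
    \<open>{K..<K+m}\<close> to bound the tail.\<close>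
  have sum_choose: "(\<Sum>k\<in>A. real (i choose k) * t ^ k) \<le> (1 + t) ^ i"
    if "t \<ge> 0" "finite A" for i :: nat and t :: real and A
  proof -
    have "(\<Sum>k\<in>A. real (i choose k) * t ^ k) \<le> (\<Sum>k\<in>A \<union> {..i}. real (i choose k) * t ^ k)"
      using that by (intro sum_mono2) auto
    also have "\<dots> = (\<Sum>k\<le>i. real (i choose k) * t ^ k)"
      using that by (intro sum.mono_neutral_right) auto
    also have "\<dots> = (1 + t) ^ i" using binomial_ring[of t 1 i] by (simp add: add.commute)
    finally show ?thesis .
  qed
  have pow_exp: "(1 + c * \<delta>) ^ i \<le> exp (c * real M)" if "i < m" "c \<ge> 0" for i c
  proof -
    have "(1 + c * \<delta>) ^ i \<le> exp (c * \<delta>) ^ i" using that \<delta> by (intro power_mono exp_ge_add_one_self) auto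
    also have "\<dots> = exp (c * (real i * \<delta>))" by (simp flip: exp_of_nat_mult add: ac_simps)
    also have "\<dots> \<le> exp (c * (real m * \<delta>))" using that \<delta>(1) by (auto intro!: mult_left_mono mult_right_mono simp del: mult_le_cancel_right)
    finally show ?thesis by (simp add: \<delta>)
  qed
  have b_le: "b u k * \<delta> ^ k \<le> real m * exp (real M)" for u k
  proof -
    have "b u k * \<delta> ^ k = (\<Sum>i<m. of_bool (u ! i) * (real (i choose k) * \<delta> ^ k))"
      by (simp add: b_def sum_distrib_right mult.assoc)
    also have "\<dots> \<le> (\<Sum>i<m. exp (real M))"
    proof (rule sum_mono)
      fix i assume "i \<in> {..<m}"
      have "of_bool (u ! i) * (real (i choose k) * \<delta> ^ k) \<le> real (i choose k) * \<delta> ^ k"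
        using \<delta> by (auto simp: of_bool_def)
      also have "\<dots> \<le> (1 + \<delta>) ^ i" using sum_choose[of \<delta> "{k}" i] \<delta> by simp
      also have "\<dots> \<le> exp (real M)" using pow_exp[of i 1] \<open>i \<in> _\<close> by simp
      finally show "of_bool (u ! i) * (real (i choose k) * \<delta> ^ k) \<le> exp (real M)" .
    qed
    finally show ?thesis by simp
  qed
  have b_nonneg: "b u k \<ge> 0" for u k unfolding b_def by (intro sum_nonneg) auto
  have F_in: "F u \<in> {..<K} \<rightarrow>\<^sub>E {..B}" for u
  proof -
    have "b u k * \<delta> ^ k * exp (real M) \<le> real m * exp (2 * real M)" for k
      using mult_right_mono[OF b_le[of u k], of "exp (real M)"] by (simp add: mult.assoc flip: exp_add)
    then show ?thesis
      unfolding F_def B_def by (intro restrict_PiE_iff[THEN iffD2]) (auto intro!: nat_mono floor_mono)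
  qed
  define S where "S = {u :: bool list. length u = m}"
  have card_S: "card S = 2 ^ m" and fin_S: "finite S"
    using card_lists_length_eq[of "UNIV :: bool set" m] finite_lists_length_eq[of "UNIV :: bool set" m]
    by (simp_all add: S_def)
  \<comment> \<open>At most \<open>exp (3M)\<close> boxes for each of \<open>4M\<close> coefficients, against \<open>2 ^ (24 M\<^sup>2)\<close> polynomials;
    the 24 is chosen so that \<open>exp 1 < 4\<close> suffices.\<close>
  have "card (F ` S) \<le> card ({..<K} \<rightarrow>\<^sub>E {..B})"
    using F_in by (intro card_mono finite_PiE) auto
  also have "\<dots> = (B + 1) ^ K" by (simp add: card_PiE)
  also have "\<dots> < 2 ^ m"
  proof -
    have "real B + 1 \<le> real m * exp (2 * real M) + 1" by (simp add: B_def)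
    also have "\<dots> \<le> (real m + 1) * exp (2 * real M)" by (simp add: algebra_simps)
    also have "\<dots> \<le> exp (real M) * exp (2 * real M)" using M by (intro mult_right_mono) auto
    also have "\<dots> = exp (3 * real M)" by (simp flip: exp_add)
    finally have "(real B + 1) ^ K \<le> exp (3 * real M) ^ K" by (intro power_mono) auto
    also have "\<dots> = exp 1 ^ (12 * M ^ 2)"
      by (simp flip: exp_of_nat_mult add: K_def power2_eq_square)
    also have "\<dots> < 4 ^ (12 * M ^ 2)"
      using exp_le M by (intro power_strict_mono) auto
    also have "(4::real) ^ (12 * M ^ 2) = 2 ^ m"
      using power_mult[of "2::real" 2 "12 * M ^ 2"] by (simp add: m_def)
    finally have "real ((B + 1) ^ K) < real (2 ^ m)" by (simp add: add.commute)
    then show ?thesis by linarith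
  qed
  finally have "\<not> inj_on F S" using card_S by (intro pigeonhole) simp
  then obtain u v where uv: "length u = m" "length v = m" "u \<noteq> v" "F u = F v"
    by (auto simp: inj_on_def S_def)
  define a where "a i = (of_bool (u ! i) - of_bool (v ! i) :: real)" for i
  have a: "\<bar>a i\<bar> \<le> 1" for i by (simp add: a_def of_bool_def)
  have "norm (\<Sum>i<m. of_real (a i) * z ^ i) \<le> 28 * real M ^ 2 * exp (- real M)"
    if z: "norm (z - 1) \<le> \<delta>" for z :: complex
  proof -
    \<comment> \<open>The expansion at 1 is extended by vanishing binomials to the range below
      \<open>K + m\<close>, so that the cut at \<open>K\<close> is the same for all
      \<open>i\<close>.\<close>
    have zi: "z ^ i = (\<Sum>k<K. of_nat (i choose k) * (z - 1) ^ k)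
        + (\<Sum>k=K..<K+m. of_nat (i choose k) * (z - 1) ^ k)" if "i < m" for i
    proof -
      have "z ^ i = ((z - 1) + 1) ^ i" by simp
      also have "\<dots> = (\<Sum>k\<le>i. of_nat (i choose k) * (z - 1) ^ k)" unfolding binomial_ring by simp
      also have "\<dots> = (\<Sum>k<K+m. of_nat (i choose k) * (z - 1) ^ k)"
        using that by (intro sum.mono_neutral_left) auto
      also have "{..<K+m} = {..<K} \<union> {K..<K+m}" by auto
      finally show ?thesis by (subst (asm) sum.union_disjoint) auto
    qed
    define H where "H = (\<Sum>i<m. of_real (a i) * (\<Sum>k<K. of_nat (i choose k) * (z - 1) ^ k))"
    define R where "R = (\<Sum>i<m. of_real (a i) * (\<Sum>k=K..<K+m. of_nat (i choose k) * (z - 1) ^ k))"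
    have split: "(\<Sum>i<m. of_real (a i) * z ^ i) = H + R"
      by (simp add: zi H_def R_def distrib_left sum.distrib)
    have "H = (\<Sum>k<K. of_real (b u k - b v k) * (z - 1) ^ k)"
      unfolding H_def sum_distrib_left
      by (subst sum.swap)
         (simp add: b_def a_def sum_distrib_right left_diff_distrib mult.assoc
           sum_subtractf del: sum_of_bool_mult_eq sum_mult_of_bool_eq)
    also have "norm \<dots> \<le> (\<Sum>k<K. exp (- real M))"
    proof (rule sum_norm_le)
      fix k assume k: "k \<in> {..<K}"
      let ?f = "\<lambda>u. b u k * \<delta> ^ k * exp (real M)"
      have "nat \<lfloor>?f u\<rfloor> = nat \<lfloor>?f v\<rfloor>"
        using fun_cong[OF uv(4), of k] k by (simp add: F_def)
      \<comment> \<open>Nonnegativity makes \<open>nat\<close> lossless here, so equal boxes mean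
        equal floors.\<close>
      moreover have "0 \<le> ?f u" "0 \<le> ?f v" using \<delta> by (simp_all add: b_nonneg)
      ultimately have "\<lfloor>?f u\<rfloor> = \<lfloor>?f v\<rfloor>" by (metis eq_nat_nat_iff zero_le_floor)
      then have "\<bar>?f u - ?f v\<bar> \<le> 1" by linarith
      then have "\<bar>(b u k - b v k) * \<delta> ^ k\<bar> * exp (real M) \<le> 1"
        by (simp add: left_diff_distrib abs_mult_pos)
      then have *: "\<bar>(b u k - b v k) * \<delta> ^ k\<bar> \<le> exp (- real M)"
        by (simp add: exp_minus field_simps)
      have "norm (of_real (b u k - b v k) * (z - 1) ^ k) \<le> \<bar>b u k - b v k\<bar> * \<delta> ^ k"
        unfolding norm_mult norm_power norm_of_real using z by (intro mult_left_mono power_mono) auto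
      also have "\<dots> \<le> exp (- real M)" using * \<delta> by (simp add: abs_mult)
      finally show "norm (of_real (b u k - b v k) * (z - 1) ^ k) \<le> exp (- real M)" .
    qed
    finally have H: "norm H \<le> real K * exp (- real M)" by simp
    \<comment> \<open>The tail at radius \<open>\<delta>\<close> is at most \<open>exp (-K)\<close> times the full sum at radius \<open>exp 1 * \<delta>\<close>.\<close>
    have "norm R \<le> (\<Sum>i<m. exp (- real M))"
      unfolding R_def
    proof (rule sum_norm_le)
      fix i assume i: "i \<in> {..<m}"
      have "norm (\<Sum>k=K..<K+m. of_nat (i choose k) * (z - 1) ^ k)
          \<le> (\<Sum>k=K..<K+m. exp (- real K) * (real (i choose k) * (exp 1 * \<delta>) ^ k))"
      proof (rule sum_norm_le)
        fix k assume k: "k \<in> {K..<K+m}"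
        have "norm (of_nat (i choose k) * (z - 1) ^ k) \<le> real (i choose k) * \<delta> ^ k"
          unfolding norm_mult norm_power norm_of_nat using z by (intro mult_left_mono power_mono) auto
        also have "\<dots> \<le> exp (real k - real K) * (real (i choose k) * \<delta> ^ k)"
          using k \<delta> mult_right_mono[of 1 "exp (real k - real K)" "real (i choose k) * \<delta> ^ k"] by auto
        also have "\<dots> = exp (- real K) * (real (i choose k) * (exp 1 * \<delta>) ^ k)"
          by (simp add: power_mult_distrib exp_diff exp_minus field_simps flip: exp_of_nat_mult)
        finally show "norm (of_nat (i choose k) * (z - 1) ^ k)
            \<le> exp (- real K) * (real (i choose k) * (exp 1 * \<delta>) ^ k)" .
      qed
      also have "\<dots> \<le> exp (- real K) * (1 + exp 1 * \<delta>) ^ i"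
        unfolding sum_distrib_left[symmetric] using \<delta> by (intro mult_left_mono sum_choose) auto
      also have "\<dots> \<le> exp (- real K) * exp (exp 1 * real M)"
        using i by (intro mult_left_mono pow_exp) auto
      also have "\<dots> \<le> exp (- real K) * exp (3 * real M)"
        using exp_le by (simp add: mult_right_mono)
      also have "\<dots> = exp (- real M)" by (simp add: K_def flip: exp_add)
      finally have "norm (\<Sum>k=K..<K+m. of_nat (i choose k) * (z - 1) ^ k) \<le> exp (- real M)" .
      then have "\<bar>a i\<bar> * norm (\<Sum>k=K..<K+m. of_nat (i choose k) * (z - 1) ^ k) \<le> 1 * exp (- real M)"
        using a by (intro mult_mono) auto
      then show "norm (of_real (a i) * (\<Sum>k=K..<K+m. of_nat (i choose k) * (z - 1) ^ k)) \<le> exp (- real M)"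
        by (simp add: norm_mult)
    qed
    then have R: "norm R \<le> real m * exp (- real M)" by simp
    have "norm (\<Sum>i<m. of_real (a i) * z ^ i) \<le> (real K + real m) * exp (- real M)"
      unfolding split using norm_triangle_ineq[of H R] H R by (simp add: algebra_simps)
    \<comment> \<open>\<open>K + m = 4 * M + 24 * M ^ 2\<close>, and
      \<open>M \<le> M ^ 2\<close>.\<close>
    also have "\<dots> \<le> 28 * real M ^ 2 * exp (- real M)"
      using M by (intro mult_right_mono) (auto simp: K_def m_def power2_eq_square)
    finally show ?thesis .
  qed
  with uv show ?thesis unfolding a_def \<delta>_def by blast
qed

section \<open>Smallness on the whole circle\<close>

text \<open>Turns distance from the tangency point 1 into decay of \<open>z ^ h\<close>. Once
  \<open>Im w\<close> is eliminated, \<open>1 - (norm z)\<^sup>2\<close> and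
  \<open>(norm (z - 1))\<^sup>2\<close> are both multiples of \<open>1 - Re w\<close>.\<close>

lemma norm_sq_circle:
  fixes w :: complex
  assumes q: "q < 1" and w: "norm w = 1"
  defines "z \<equiv> of_real q + of_real (1 - q) * w"
  shows "(norm z)\<^sup>2 = 1 - q / (1 - q) * (norm (z - 1))\<^sup>2"
proof -
  have sq: "(Re w)\<^sup>2 + (Im w)\<^sup>2 = 1" using w by (simp add: cmod_def)
  have 1: "(norm z)\<^sup>2 = (q + (1 - q) * Re w)\<^sup>2 + ((1 - q) * Im w)\<^sup>2" by (simp add: z_def cmod_power2)
  have 2: "(norm (z - 1))\<^sup>2 = (q + (1 - q) * Re w - 1)\<^sup>2 + ((1 - q) * Im w)\<^sup>2" by (simp add: z_def cmod_power2)
  have im: "(Im w)\<^sup>2 = 1 - (Re w)\<^sup>2" using sq by simp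
  have 3: "(norm (z - 1))\<^sup>2 = (1 - q)\<^sup>2 * (2 - 2 * Re w)"
    unfolding 2 power_mult_distrib im by (simp add: power2_eq_square algebra_simps)
  have "q / (1 - q) * (norm (z - 1))\<^sup>2 = q * (1 - q) * (2 - 2 * Re w)"
    unfolding 3 using q by (simp add: power2_eq_square)
  then show ?thesis
    unfolding 1 power_mult_distrib im by (simp add: power2_eq_square algebra_simps)
qed

text \<open>Prefixing \<open>h\<close> zeros to the two pigeonhole strings multiplies their
  difference polynomial \<open>Q\<close> by \<open>z ^ h\<close>. Near 1 the bound on
  \<open>Q\<close> suffices; farther away \<open>norm Q \<le> m\<close> and the decay of
  \<open>z ^ h\<close> suffice.\<close>

lemma exists_small_on_circle:
  fixes M n :: nat
  assumes q: "0 < q" "q < 1" and M: "1 \<le> M" "real (24 * M ^ 2) + 1 \<le> exp (real M)"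
    and n: "(24 * M) ^ 3 \<le> n"
  shows "\<exists>x y :: bool list. length x = n \<and> length y = n \<and> x \<noteq> y \<and>
    (\<forall>w::complex. norm w = 1 \<longrightarrow>
      norm (\<Sum>k<n. of_real (of_bool (x ! k) - of_bool (y ! k)) * (of_real q + of_real (1 - q) * w) ^ k)
        \<le> 28 * real M ^ 2 * exp (- q * real M))"
proof -
  define m where "m = 24 * M ^ 2"
  obtain u v :: "bool list" where len: "length u = m" "length v = m" and "u \<noteq> v"
    and near: "\<And>z::complex. norm (z - 1) \<le> 1 / (24 * real M) \<Longrightarrow>
      norm (\<Sum>i<m. of_real (of_bool (u ! i) - of_bool (v ! i)) * z ^ i) \<le> 28 * real M ^ 2 * exp (- real M)"
    using exists_small_near_one[OF M] unfolding m_def by blast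
  have n': "13824 * M ^ 3 \<le> n" using n by (simp add: power_mult_distrib)
  have "M ^ 2 \<le> M ^ 3" using M by (intro power_increasing) auto
  then have mn: "2 * m \<le> n" using n' by (simp add: m_def)
  \<comment> \<open>As \<open>2 * m \<le> n\<close>, the zero prefix takes up at least half of the
    string, so \<open>h\<close> is of order \<open>M ^ 3\<close> or more.\<close>
  define h where "h = n - m"
  have hm: "n = h + m" "n \<le> 2 * h" using mn by (simp_all add: h_def)
  define x where "x = replicate h False @ u"
  define y where "y = replicate h False @ v"
  define a where "a i = complex_of_real (of_bool (u ! i) - of_bool (v ! i))" for i
  have "norm (\<Sum>k<n. of_real (of_bool (x ! k) - of_bool (y ! k)) * (of_real q + of_real (1 - q) * w) ^ k)
      \<le> 28 * real M ^ 2 * exp (- q * real M)" if w: "norm w = 1" for w :: complex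
  proof -
    define z where "z = of_real q + of_real (1 - q) * w"
    define Q where "Q = (\<Sum>i<m. a i * z ^ i)"
    have nz: "(norm z)\<^sup>2 = 1 - q / (1 - q) * (norm (z - 1))\<^sup>2"
      using norm_sq_circle[OF q(2) w] by (simp add: z_def)
    have "0 \<le> q / (1 - q) * (norm (z - 1))\<^sup>2" using q by simp
    then have "(norm z)\<^sup>2 \<le> 1" using nz by linarith
    then have z1: "norm z \<le> 1" by (simp add: abs_square_le_1)
    have "(\<Sum>k<n. of_real (of_bool (x ! k) - of_bool (y ! k)) * z ^ k) =
        (\<Sum>k<h. of_real (of_bool (x ! k) - of_bool (y ! k)) * z ^ k) +
        (\<Sum>k<m. of_real (of_bool (x ! (h + k)) - of_bool (y ! (h + k))) * z ^ (h + k))"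
      unfolding hm(1) by (induction m) (simp_all add: algebra_simps)
    also have "(\<Sum>k<h. of_real (of_bool (x ! k) - of_bool (y ! k)) * z ^ k) = 0"
      by (intro sum.neutral) (auto simp: x_def y_def nth_append)
    also have "(\<Sum>k<m. of_real (of_bool (x ! (h + k)) - of_bool (y ! (h + k))) * z ^ (h + k)) = z ^ h * Q"
      by (simp add: Q_def sum_distrib_left x_def y_def nth_append power_add mult.left_commute a_def)
    finally have eq: "norm (\<Sum>k<n. of_real (of_bool (x ! k) - of_bool (y ! k)) * z ^ k) = norm z ^ h * norm Q"
      by (simp add: norm_mult norm_power)
    have "norm z ^ h * norm Q \<le> 28 * real M ^ 2 * exp (- q * real M)"
    proof (cases "norm (z - 1) \<le> 1 / (24 * real M)")
      case True
      have "norm z ^ h * norm Q \<le> 1 * (28 * real M ^ 2 * exp (- real M))"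
        using near[OF True] z1 by (intro mult_mono power_le_one) (auto simp: Q_def a_def)
      also have "\<dots> \<le> 28 * real M ^ 2 * exp (- q * real M)"
        using q by (auto intro!: mult_left_mono mult_left_le_one_le)
      finally show ?thesis .
    next
      case False
      \<comment> \<open>Far from 1, \<open>(norm z)\<^sup>2\<close> falls below 1 by at least
        \<open>q / (576 * M ^ 2)\<close>; raised to the power \<open>h\<close>, this gives decay at
        least \<open>exp (- 2 * q * M)\<close>.\<close>
      have "(1 / (24 * real M))\<^sup>2 \<le> (norm (z - 1))\<^sup>2"
        using False by (intro power_mono) auto
      then have "q * (1 / (24 * real M))\<^sup>2 \<le> q / (1 - q) * (norm (z - 1))\<^sup>2"
        using q by (intro mult_mono) (auto simp: field_simps)
      then have "(norm z)\<^sup>2 \<le> 1 + - (q * (1 / (24 * real M))\<^sup>2)" using nz by linarith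
      also have "\<dots> \<le> exp (- (q * (1 / (24 * real M))\<^sup>2))" by (rule exp_ge_add_one_self)
      finally have "((norm z)\<^sup>2) ^ h \<le> exp (- (q * (1 / (24 * real M))\<^sup>2)) ^ h"
        by (intro power_mono) auto
      also have "\<dots> = exp (- (q * (real h / (576 * real M ^ 2))))"
        unfolding exp_of_nat_mult[symmetric] by (simp add: power_mult_distrib power_divide)
      also have "\<dots> \<le> exp (- (q * (2 * real M)))"
      proof -
        have "real (13824 * M ^ 3) \<le> real (2 * h)"
          using n' hm(2) by (simp only: of_nat_le_iff)
        then have "13824 * real M ^ 3 \<le> 2 * real h" by simp
        moreover have "0 \<le> real M ^ 3" by simp
        ultimately have "2 * real M * (576 * real M ^ 2) \<le> real h"
          by (simp add: power2_eq_square power3_eq_cube)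
        then have "2 * real M \<le> real h / (576 * real M ^ 2)"
          using M by (simp add: pos_le_divide_eq)
        then have "q * (2 * real M) \<le> q * (real h / (576 * real M ^ 2))"
          using q by (intro mult_left_mono) auto
        then show ?thesis by (simp only: exp_le_cancel_iff neg_le_iff_le)
      qed
      also have "\<dots> = (exp (- q * real M))\<^sup>2" unfolding exp_of_nat_mult[symmetric] by simp
      finally have "(norm z ^ h)\<^sup>2 \<le> (exp (- q * real M))\<^sup>2"
        by (simp add: power_mult[symmetric] mult.commute)
      then have zh: "norm z ^ h \<le> exp (- q * real M)"
        by (rule power2_le_imp_le) simp
      have "norm Q \<le> (\<Sum>i<m. 1)"
        unfolding Q_def
      proof (rule sum_norm_le)
        fix i
        have "norm (a i) \<le> 1" by (simp add: a_def of_bool_def)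
        then show "norm (a i * z ^ i) \<le> 1"
          unfolding norm_mult norm_power using z1 by (intro mult_le_one power_le_one) auto
      qed
      then have "norm Q \<le> 24 * real M ^ 2" by (simp add: m_def)
      also have "\<dots> \<le> 28 * real M ^ 2" by simp
      finally have "norm Q \<le> 28 * real M ^ 2" .
      then have "norm z ^ h * norm Q \<le> exp (- q * real M) * (28 * real M ^ 2)"
        using zh by (intro mult_mono) auto
      then show ?thesis by (simp only: mult.commute)
    qed
    then show ?thesis using eq unfolding z_def by linarith
  qed
  moreover have "length x = n" "length y = n" "x \<noteq> y"
    using hm len \<open>u \<noteq> v\<close> by (auto simp: x_def y_def)
  ultimately show ?thesis by blast
qed

section \<open>Small lengths and choice of constants\<close>

text \<open>Serves the small \<open>n\<close>. The strings differ only in their last bit, which must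
  be retained to be seen.\<close>

lemma exists_bit_prob_diff_le:
  assumes q: "0 < q" "q < 1" and n: "n \<ge> 1"
  shows "\<exists>x y :: bool list. length x = n \<and> length y = n \<and> x \<noteq> y \<and>
    (\<forall>j. \<bar>bit_prob q x j - bit_prob q y j\<bar> \<le> 1 - q)"
proof (intro exI conjI allI)
  let ?w = "replicate (n - 1) False"
  show "length (?w @ [True]) = n" "length (?w @ [False]) = n" "?w @ [True] \<noteq> ?w @ [False]"
    using n by auto
  show "\<bar>bit_prob q (?w @ [True]) j - bit_prob q (?w @ [False]) j\<bar> \<le> 1 - q" for j
    using q pmf_le_1[of "binomial_pmf (n - 1) (1 - q)" j]
    by (simp add: bit_prob_snoc abs_mult mult_left_le del: pmf_binomial)
qed

theorem theorem1p2:
  fixes q :: real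
  assumes "0 < q" and "q < 1"
  shows "\<exists>c>0. \<forall>n\<ge>1. \<exists>x y :: bool list.
           length x = n \<and> length y = n \<and> x \<noteq> y \<and>
           (\<forall>j. \<forall>T\<ge>1. tv_dist (bit_samples q x j T) (bit_samples q y j T)
                        \<le> real T * exp (- c * real n powr (1 / 3)))"
proof -
  \<comment> \<open>The last condition absorbs the factor \<open>28 * M ^ 2\<close> at the price of
    half the exponent.\<close>
  have "eventually (\<lambda>M::nat. 1 \<le> M \<and> 24 * real M ^ 2 + 1 \<le> exp (real M) \<and>
      28 * real M ^ 2 * exp (- q * real M) \<le> exp (- (q / 2) * real M)) at_top"
  proof (intro eventually_conj)
    show "eventually (\<lambda>M::nat. 24 * real M ^ 2 + 1 \<le> exp (real M)) at_top" by real_asymp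
    show "eventually (\<lambda>M::nat. 28 * real M ^ 2 * exp (- q * real M) \<le> exp (- (q / 2) * real M)) at_top"
      using assms by real_asymp
  qed (rule eventually_ge_at_top)
  then obtain M0 :: nat where M0: "\<And>M. M \<ge> M0 \<Longrightarrow> 1 \<le> M \<and> 24 * real M ^ 2 + 1 \<le> exp (real M) \<and>
      28 * real M ^ 2 * exp (- q * real M) \<le> exp (- (q / 2) * real M)"
    by (auto simp: eventually_at_top_linorder)
  \<comment> \<open>The second term of \<open>c\<close> covers the finitely many \<open>n\<close> with \<open>n powr (1 / 3) \<le> L\<close>.\<close>
  define L where "L = 24 * (real M0 + 1)"
  define c where "c = min (q / 96) (- ln (1 - q) / L)"
  have "L > 0" by (simp add: L_def)
  have "c > 0" using assms \<open>L > 0\<close> by (simp add: c_def divide_neg_pos)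
  have "\<exists>x y :: bool list. length x = n \<and> length y = n \<and> x \<noteq> y \<and>
      (\<forall>j. \<bar>bit_prob q x j - bit_prob q y j\<bar> \<le> exp (- c * real n powr (1 / 3)))" if "n \<ge> 1" for n
  proof (cases "real n powr (1 / 3) \<le> L")
    case True
    \<comment> \<open>The right-hand side is \<open>- ln (1 - q)\<close>, so the gap
      \<open>1 - q\<close> of the trivial pair is already small enough.\<close>
    have "c * real n powr (1 / 3) \<le> - ln (1 - q) / L * L"
      using True assms \<open>L > 0\<close> \<open>c > 0\<close> by (intro mult_mono) (auto simp: c_def divide_nonpos_pos)
    then have "exp (ln (1 - q)) \<le> exp (- c * real n powr (1 / 3))" using \<open>L > 0\<close> by simp
    then have "1 - q \<le> exp (- c * real n powr (1 / 3))" using assms by simp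
    then show ?thesis using exists_bit_prob_diff_le[OF assms that] order.trans by blast
  next
    case False
    define r where "r = real n powr (1 / 3)"
    have r3: "r ^ 3 = real n" using that by (simp add: r_def powr_powr flip: powr_realpow)
    \<comment> \<open>The largest \<open>M\<close> with \<open>24 * M \<le> r\<close>, that is, with
      \<open>(24 * M) ^ 3 \<le> n\<close>.\<close>
    define M where "M = nat \<lfloor>r / 24\<rfloor>"
    have r: "r > 24 * (real M0 + 1)" using False by (simp add: r_def L_def)
    then have M_le: "real M \<le> r / 24" and M_gt: "real M > r / 24 - 1" by (simp_all add: M_def) linarith+
    have "real M0 \<le> real M" using r M_gt by simp
    then have "M0 \<le> M" by simp
    then have M: "1 \<le> M" "24 * real M ^ 2 + 1 \<le> exp (real M)"
      "28 * real M ^ 2 * exp (- q * real M) \<le> exp (- (q / 2) * real M)" using M0 by auto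
    \<comment> \<open>From \<open>M \<ge> 1\<close>, \<open>2 * M \<ge> M + 1 > r / 24\<close>.
      Together with the exponent \<open>q / 2\<close> this produces the \<open>q / 96\<close> in
      \<open>c\<close>.\<close>
    have Mr: "r / 48 \<le> real M" using M_gt M(1) by linarith
    have "(24 * real M) ^ 3 \<le> r ^ 3" using M_le by (intro power_mono) auto
    then have "real ((24 * M) ^ 3) \<le> real n" by (simp add: r3)
    then have "(24 * M) ^ 3 \<le> n" by linarith
    with exists_small_on_circle[OF assms M(1), of n] M(2)
    obtain x y :: "bool list" where xy: "length x = n" "length y = n" "x \<noteq> y"
      and small: "\<And>w::complex. norm w = 1 \<Longrightarrow>
        norm (\<Sum>k<n. of_real (of_bool (x ! k) - of_bool (y ! k)) * (of_real q + of_real (1 - q) * w) ^ k)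
          \<le> 28 * real M ^ 2 * exp (- q * real M)" by auto
    have "c * r \<le> q / 96 * r" unfolding c_def using r by (intro mult_right_mono min.cobounded1) auto
    also have "\<dots> \<le> q / 2 * real M" using mult_left_mono[OF Mr, of "q / 2"] assms by simp
    finally have "exp (- (q / 2) * real M) \<le> exp (- c * r)" by simp
    then have "\<bar>bit_prob q x j - bit_prob q y j\<bar> \<le> exp (- c * r)" for j
      using bit_prob_diff_le_sup_circle[OF assms xy(1,2) small, of j] M(3) by linarith
    then show ?thesis using xy unfolding r_def by blast
  qed
  then show ?thesis
    using \<open>c > 0\<close> by (meson order.trans[OF tv_dist_bit_samples_le] mult_left_mono of_nat_0_le_iff)
qed

end
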